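(* For $n\ge 3$ let $c_n$ denote the number of optimal strategies for Player I in the Penney-Ante game with strings of length $n$. Then $$c_n=2c_{n-1}-(-1)^n c_{\lfloor n/2\rfloor+1}\qquad\text{for all } n\ge 6.$$
   Context: Penney-Ante game with strings of length $n\ge3$: Player I chooses a string $A\in\{H,T\}^n$; Player II, seeing $A$, chooses a string $B\in\{H,T\}^n$ with $B\ne A$. A fair coin is tossed repeatedly (independent tosses) producing an infinite $H/T$ sequence, and the player whose string first appears as a block of consecutive tosses wins. A string $A$ is an optimal strategy for Player I if it maximizes, over all $A\in\{H,T\}^n$, the quantity $\min_{B\ne A} P(A\text{ appears before }B)$, i.e. Player I's winning probability assuming Player II responds optimally. $c_n$ is the number of such optimal strings $A$ (e.g. $c_3=4$, $c_4=2$, $c_5=2$). *)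

theory Defs
  imports "HOL-Probability.Probability"
begin

datatype coin = Heads | Tails

instance coin :: countable
  by countable_datatype

definition toss_space :: "coin stream measure" where
  "toss_space = stream_space (measure_pmf (pmf_of_set {Heads, Tails}))"

definition occurs_at :: "coin list \<Rightarrow> coin stream \<Rightarrow> nat \<Rightarrow> bool" where
  "occurs_at A \<omega> i \<longleftrightarrow> stake (length A) (sdrop i \<omega>) = A"

text \<open>
  Occurrences are compared by the position where they start. In the game both strings have
  the same length, so this is the same as comparing when they are completed. The strings are
  moreover distinct, so they cannot start at the same position.
\<close>

definition appears_before :: "coin list \<Rightarrow> coin list \<Rightarrow> coin stream \<Rightarrow> bool" where
  "appears_before A B \<omega> \<longleftrightarrow> (\<exists>i. occurs_at A \<omega> i \<and> (\<forall>j\<le>i. \<not> occurs_at B \<omega> j))"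

definition prob_before :: "coin list \<Rightarrow> coin list \<Rightarrow> real" where
  "prob_before A B = measure toss_space {\<omega> \<in> space toss_space. appears_before A B \<omega>}"

lemma appears_before_measurable:
  "{\<omega> \<in> space toss_space. appears_before A B \<omega>} \<in> sets toss_space"
proof -
  have sp: "space toss_space = UNIV"
    by (simp add: toss_space_def space_stream_space)
  have st: "sets toss_space = sets (stream_space (count_space UNIV))"
    unfolding toss_space_def by (intro sets_stream_space_cong) simp
  have "Measurable.pred (stream_space (count_space UNIV)) (\<lambda>\<omega>. occurs_at C \<omega> i)" for C i
    unfolding occurs_at_def by measurable
  note this[measurable]
  have "Measurable.pred (stream_space (count_space UNIV)) (appears_before A B)"
    unfolding appears_before_def[abs_def] by measurable
  then show ?thesis
    by (simp add: sp st pred_def space_stream_space)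
qed

definition strings :: "nat \<Rightarrow> coin list set" where
  "strings n = {A. length A = n}"

text \<open>
  Player I's winning probability with \<open>A\<close> when Player II answers optimally. For \<open>n \<ge> 1\<close> the
  minimum is over a finite nonempty set.
\<close>

definition guaranteed_prob :: "nat \<Rightarrow> coin list \<Rightarrow> real" where
  "guaranteed_prob n A = Min (prob_before A ` (strings n - {A}))"

definition optimal_strategies :: "nat \<Rightarrow> coin list set" where
  "optimal_strategies n =
     {A \<in> strings n. \<forall>A' \<in> strings n. guaranteed_prob n A' \<le> guaranteed_prob n A}"

definition num_optimal :: "nat \<Rightarrow> nat" where
  "num_optimal n = card (optimal_strategies n)"

end

theory Submission
  imports Defs
begin

text \<open>
  By Conway's formula the odds of \<open>B\<close> against \<open>A\<close> are \<open>AA - AB : BB - BA\<close>, where \<open>XY\<close> is the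
  correlation of \<open>X\<close> and \<open>Y\<close>. For \<open>A = wg\<close> with a last letter \<open>g\<close> the dangerous answers are
  \<open>B = bw\<close>, and \<open>2 (BB - BA) - (AA - AB)\<close> is then a signed sum of powers of \<open>2\<close> over the borders
  of \<open>w\<close>. The longest border dominates this sum, and for a suitable \<open>b\<close> it is nonpositive, so that
  \<open>A\<close> wins with probability at most \<open>1/3\<close>. The only exceptions are the words
  \<open>A = c d \<dots> d c c\<close>, \<open>d \<noteq> c\<close>, for which \<open>w = c d \<dots> d c\<close> has no proper border of length at
  least \<open>2\<close>; they all guarantee the same probability \<open>(x + 1) / (3 x + 2) > 1/3\<close> with
  \<open>x = 2\<^sup>n\<^sup>-\<^sup>2\<close> and hence are the optimal ones. They are counted by the length of \<open>w\<close>: a word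
  with a forbidden border has one that overlaps itself in at most one letter, so inserting
  letters in the middle of \<open>w\<close> leads to the recurrence, as for words without borders.
\<close>

section \<open>Events decided by finitely many tosses\<close>

lemma prob_space_toss_space: "prob_space toss_space"
  unfolding toss_space_def
  by (intro prob_space.prob_space_stream_space prob_space_measure_pmf)

lemma space_toss_space [simp]: "space toss_space = UNIV"
  by (simp add: toss_space_def space_stream_space)

lemma sets_toss_space: "sets toss_space = sets (stream_space (count_space UNIV))"
  unfolding toss_space_def by (intro sets_stream_space_cong) simp

lemma stake_event_measurable [measurable]: "{\<omega>. P (stake k \<omega>)} \<in> sets toss_space"
proof -
  have "Measurable.pred (stream_space (count_space UNIV)) (\<lambda>\<omega>::coin stream. P (stake k \<omega>))"
    by measurable
  then show ?thesis
    by (simp add: sets_toss_space pred_def space_stream_space)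
qed

lemma emeasure_stake_eq:
  "emeasure toss_space {\<omega>. stake (length v) \<omega> = v} = ennreal (1 / 2 ^ length v)"
proof (induction v)
  case Nil
  then show ?case
    using prob_space.emeasure_space_1[OF prob_space_toss_space] by simp
next
  case (Cons c v)
  have "emeasure toss_space {\<omega>. stake (length (c # v)) \<omega> = c # v}
    = (\<integral>\<^sup>+t. emeasure toss_space {\<omega> \<in> space toss_space. t ## \<omega> \<in> {\<omega>. stake (length (c # v)) \<omega> = c # v}}
        \<partial>measure_pmf (pmf_of_set {Heads, Tails}))"
    using stake_event_measurable[of "\<lambda>x. x = c # v" "length (c # v)"]
    unfolding toss_space_def
    by (intro prob_space.emeasure_stream_space prob_space_measure_pmf) auto
  also have "\<dots> = (\<integral>\<^sup>+t. (if t = c then ennreal (1 / 2 ^ length v) else 0) \<partial>measure_pmf (pmf_of_set {Heads, Tails}))"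
    by (intro nn_integral_cong) (auto simp: Cons.IH)
  also have "\<dots> = ennreal (1 / 2 ^ length (c # v))"
    by (cases c) (simp_all add: nn_integral_pmf_of_set ennreal_divide_numeral mult.commute)
  finally show ?case .
qed

lemma finite_strings [simp]: "finite (strings k)"
proof -
  have "finite (UNIV :: coin set)"
    by (rule finite_subset[of _ "{Heads, Tails}"]) (auto intro: coin.exhaust)
  then show ?thesis
    using finite_lists_length_eq[of "UNIV :: coin set" k] by (simp add: strings_def)
qed

lemma measure_stake_in:
  assumes "W \<subseteq> strings k"
  shows "measure toss_space {\<omega>. stake k \<omega> \<in> W} = card W / 2 ^ k"
proof -
  interpret prob_space toss_space by (rule prob_space_toss_space)
  have fin: "finite W" using assms by (rule finite_subset) simp
  have "{\<omega>. stake k \<omega> \<in> W} = (\<Union>v\<in>W. {\<omega>. stake k \<omega> = v})" by auto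
  then have "prob {\<omega>. stake k \<omega> \<in> W} = (\<Sum>v\<in>W. prob {\<omega>. stake k \<omega> = v})"
    using stake_event_measurable fin
    by (auto intro!: finite_measure_finite_Union simp: disjoint_family_on_def)
  also have "\<dots> = (\<Sum>v\<in>W. 1 / 2 ^ k)"
    using assms emeasure_stake_eq
    by (intro sum.cong) (auto simp: strings_def measure_def)
  finally show ?thesis by simp
qed

section \<open>Conway's formula\<close>

text \<open>Where \<open>A\<close> does not fit, the \<open>take\<close> is too short, so a nonempty
  \<open>A\<close> can only occur inside \<open>v\<close>.\<close>

definition occ_list :: "coin list \<Rightarrow> coin list \<Rightarrow> nat \<Rightarrow> bool" where
  "occ_list A v i \<longleftrightarrow> take (length A) (drop i v) = A"

lemma occ_list_length: "occ_list A v i \<Longrightarrow> A \<noteq> [] \<Longrightarrow> i + length A \<le> length v"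
  unfolding occ_list_def
  by (drule arg_cong[where f = length], cases "i \<le> length v") (auto simp: min_def split: if_splits)

lemma occ_list_unique:
  "occ_list A v i \<Longrightarrow> occ_list B v i \<Longrightarrow> length A = length B \<Longrightarrow> A = B"
  by (simp add: occ_list_def)

lemma occ_list_append:
  "i + length A \<le> length v \<Longrightarrow> occ_list A (v @ w) i \<longleftrightarrow> occ_list A v i"
  by (simp add: occ_list_def)

lemma occ_list_stake: "i + length A \<le> k \<Longrightarrow> occ_list A (stake k \<omega>) i \<longleftrightarrow> occurs_at A \<omega> i"
  by (simp add: occ_list_def occurs_at_def drop_stake take_stake min_absorb1)

definition avoiders :: "coin list \<Rightarrow> coin list \<Rightarrow> nat \<Rightarrow> coin list set" where
  "avoiders A B t = {v \<in> strings t. \<forall>i. \<not> occ_list A v i \<and> \<not> occ_list B v i}"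

text \<open>The words stop where \<open>A\<close> is completed. For distinct words of equal length,
  a win of \<open>A\<close> at position \<open>i\<close> thus becomes an event about the first
  \<open>i + length A\<close> tosses.\<close>

definition first_occ :: "coin list \<Rightarrow> coin list \<Rightarrow> nat \<Rightarrow> coin list set" where
  "first_occ A B i = {v \<in> strings (i + length A). occ_list A v i \<and>
     (\<forall>j<i. \<not> occ_list A v j \<and> \<not> occ_list B v j)}"

text \<open>Conway's leading number: its binary digits mark which ends of \<open>X\<close> are
  beginnings of \<open>Y\<close>, with the full overlap as leading digit.\<close>

definition correlation :: "coin list \<Rightarrow> coin list \<Rightarrow> real" where
  "correlation X Y = (\<Sum>d<length X.
     of_bool (drop d X = take (length X - d) Y) * 2 ^ (length X - d - 1))"

lemma finite_avoiders [simp]: "finite (avoiders A B t)"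
  by (rule finite_subset[OF _ finite_strings[of t]]) (auto simp: avoiders_def)

lemma avoiders_commute: "avoiders A B t = avoiders B A t"
  by (auto simp: avoiders_def)

text \<open>
  Appending \<open>A\<close> to a word \<open>v\<close> that avoids \<open>X\<close> and \<open>Y\<close> forces an occurrence of \<open>A\<close>, but the
  first occurrence of \<open>X\<close> or \<open>Y\<close> in \<open>v @ A\<close> may start earlier, inside \<open>v\<close>. Sorting the words
  \<open>v\<close> by the place of that occurrence is what brings in the correlations.
\<close>
definition extended_first :: "coin list \<Rightarrow> coin list \<Rightarrow> coin list \<Rightarrow> nat \<Rightarrow> nat \<Rightarrow> coin list set" where
  "extended_first X Y A t i = {v \<in> avoiders X Y t. occ_list X (v @ A) i \<and>
     (\<forall>j<i. \<not> occ_list X (v @ A) j \<and> \<not> occ_list Y (v @ A) j)}"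

text \<open>An occurrence of \<open>X\<close> starting \<open>d\<close> letters before the end of
  \<open>v\<close> reads the last \<open>d\<close> letters of \<open>v\<close> and the first
  \<open>n - d\<close> of \<open>A\<close>, which forces the match. Given the match, cutting
  \<open>v @ A\<close> at the end of this occurrence loses nothing, as the removed letters belong to
  \<open>A\<close>.\<close>

lemma card_extended_first:
  assumes len: "length X = n" "length Y = n" "length A = n" and d: "d < n" "d \<le> t"
  shows "card (extended_first X Y A t (t - d)) =
    of_bool (drop d X = take (n - d) A) * card (first_occ X Y (t - d))"
proof (cases "drop d X = take (n - d) A")
  case False
  have "extended_first X Y A t (t - d) = {}"
  proof (rule ccontr)
    assume "extended_first X Y A t (t - d) \<noteq> {}"
    then obtain v where v: "length v = t" "take n (drop (t - d) (v @ A)) = X"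
      by (auto simp: extended_first_def avoiders_def strings_def occ_list_def len)
    have "drop d X = take (n - d) A"
      using v(1) d by (subst v(2)[symmetric]) (simp add: take_drop drop_take)
    with False show False by simp
  qed
  with False show ?thesis by simp
next
  case True
  let ?i = "t - d"
  have "bij_betw (\<lambda>v. v @ take (n - d) A) (extended_first X Y A t ?i) (first_occ X Y ?i)"
  proof (rule bij_betw_byWitness[where f' = "take t"])
    have occ: "occ_list Z (v @ A) j \<longleftrightarrow> occ_list Z (v @ take (n - d) A) j"
      if "length v = t" "length Z = n" "j \<le> ?i" for v Z j
      using occ_list_append[of j Z "v @ take (n - d) A" "drop (n - d) A"] that d len by simp
    show "(\<lambda>v. v @ take (n - d) A) ` extended_first X Y A t ?i \<subseteq> first_occ X Y ?i"
      using occ d len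
      by (auto simp: extended_first_def avoiders_def strings_def first_occ_def)
    show "\<forall>v\<in>extended_first X Y A t ?i. take t (v @ take (n - d) A) = v"
      by (auto simp: extended_first_def avoiders_def strings_def)
    have decomp: "u = take t u @ take (n - d) A" "length (take t u) = t" if "u \<in> first_occ X Y ?i" for u
    proof -
      have u: "length u = ?i + n" "drop ?i u = X"
        using that len by (auto simp: first_occ_def strings_def occ_list_def)
      have "drop t u = drop d (drop ?i u)" using d by simp
      then show "u = take t u @ take (n - d) A" "length (take t u) = t"
        using u True append_take_drop_id[of t u] d by auto
    qed
    then show "\<forall>u\<in>first_occ X Y ?i. take t u @ take (n - d) A = u" by metis
    show "take t ` first_occ X Y ?i \<subseteq> extended_first X Y A t ?i"
    proof safe
      fix u assume u: "u \<in> first_occ X Y ?i"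
      define v where "v = take t u"
      have uv: "u = v @ take (n - d) A" "length v = t"
        using decomp[OF u] unfolding v_def by auto
      have no: "\<not> occ_list Z u j" if "j < ?i" "Z \<in> {X, Y}" for Z j
        using u that by (auto simp: first_occ_def)
      have "\<not> occ_list Z v j" if Z: "Z \<in> {X, Y}" for Z j
      proof
        \<comment> \<open>Inside \<open>v\<close> it would start at some
          \<open>j \<le> t - n\<close>, hence before \<open>t - d\<close> because
          \<open>d < n\<close>.\<close>
        assume o: "occ_list Z v j"
        have l: "length Z = n" using Z len by auto
        then have "Z \<noteq> []" using d by auto
        then have jn: "j + n \<le> t" using occ_list_length[OF o] l uv by simp
        then have "occ_list Z u j" using o l uv by (simp add: occ_list_append)
        moreover have "j < t - d" using jn d by linarith
        ultimately show False using no[of j Z] Z by blast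
      qed
      moreover have "occ_list X u ?i" using u by (simp add: first_occ_def)
      ultimately show "take t u \<in> extended_first X Y A t ?i"
        unfolding v_def[symmetric] extended_first_def avoiders_def strings_def
        using uv no occ[of v X] occ[of v Y] len by auto
    qed
  qed
  from bij_betw_same_card[OF this] True show ?thesis by simp
qed

text \<open>In \<open>v @ A\<close> there is an occurrence at \<open>t\<close>, hence a first one;
  as \<open>v\<close> has none, it starts fewer than \<open>n\<close> letters before the end of
  \<open>v\<close>. The range \<open>d \<le> t\<close> keeps the positions \<open>t - d\<close>
  distinct under truncated subtraction.\<close>

lemma card_avoiders:
  assumes len: "length A = n" "length B = n" and "A \<noteq> B"
  shows "card (avoiders A B t) = (\<Sum>d\<in>{d. d < n \<and> d \<le> t}.
     of_bool (drop d A = take (n - d) A) * card (first_occ A B (t - d)) +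
     of_bool (drop d B = take (n - d) A) * card (first_occ B A (t - d)))"
proof -
  let ?D = "{d. d < n \<and> d \<le> t}"
  let ?E = "\<lambda>d. extended_first A B A t (t - d) \<union> extended_first B A A t (t - d)"
  have n: "A \<noteq> []" "B \<noteq> []" using assms by auto
  have "avoiders A B t = (\<Union>d\<in>?D. ?E d)"
  proof safe
    fix v assume v: "v \<in> avoiders A B t"
    then have lv: "length v = t" by (simp add: avoiders_def strings_def)
    define P where "P i \<longleftrightarrow> occ_list A (v @ A) i \<or> occ_list B (v @ A) i" for i
    define i where "i = (LEAST i. P i)"
    have "P t" by (simp add: P_def occ_list_def lv)
    then have i: "P i" "i \<le> t" "\<And>j. j < i \<Longrightarrow> \<not> P j"
      unfolding i_def by (auto intro: LeastI Least_le dest: not_less_Least)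
    have "t < i + n"
    proof (rule ccontr)
      assume "\<not> t < i + n"
      then have "occ_list A v i \<or> occ_list B v i"
        using i(1) lv len by (simp add: P_def occ_list_append)
      then show False using v by (auto simp: avoiders_def)
    qed
    then have "t - i \<in> ?D" "t - (t - i) = i" using i(2) assms by auto
    moreover have "v \<in> extended_first A B A t i \<union> extended_first B A A t i"
      using i(1,3) v avoiders_commute[of A B] by (auto simp: extended_first_def P_def)
    ultimately show "v \<in> (\<Union>d\<in>?D. ?E d)" by (metis UN_I)
  qed (auto simp: extended_first_def avoiders_commute)
  also have "card \<dots> = (\<Sum>d\<in>?D. card (?E d))"
  proof (rule card_UN_disjoint)
    show "\<forall>d\<in>?D. finite (?E d)" by (auto simp: extended_first_def)
    show "\<forall>d\<in>?D. \<forall>d'\<in>?D. d \<noteq> d' \<longrightarrow> ?E d \<inter> ?E d' = {}"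
    proof (intro ballI impI equals0I)
      fix d d' v assume d: "d \<in> ?D" "d' \<in> ?D" "d \<noteq> d'" "v \<in> ?E d \<inter> ?E d'"
      have "t - d < t - d' \<or> t - d' < t - d" using d(1,2,3) by auto
      with d(4) show False unfolding extended_first_def by blast
    qed
  qed auto
  also have "\<dots> = (\<Sum>d\<in>?D. card (extended_first A B A t (t - d)) + card (extended_first B A A t (t - d)))"
  proof (intro sum.cong refl card_Un_disjoint)
    fix d
    show "extended_first A B A t (t - d) \<inter> extended_first B A A t (t - d) = {}"
    proof (intro equals0I)
      fix v assume "v \<in> extended_first A B A t (t - d) \<inter> extended_first B A A t (t - d)"
      then have "occ_list A (v @ A) (t - d)" "occ_list B (v @ A) (t - d)"
        unfolding extended_first_def by blast+
      then show False using occ_list_unique assms by metis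
    qed
  qed (auto simp: extended_first_def)
  also have "\<dots> = (\<Sum>d\<in>?D.
     of_bool (drop d A = take (n - d) A) * card (first_occ A B (t - d)) +
     of_bool (drop d B = take (n - d) A) * card (first_occ B A (t - d)))"
  proof (intro sum.cong refl)
    fix d assume "d \<in> ?D"
    then show "card (extended_first A B A t (t - d)) + card (extended_first B A A t (t - d)) =
      of_bool (drop d A = take (n - d) A) * card (first_occ A B (t - d)) +
      of_bool (drop d B = take (n - d) A) * card (first_occ B A (t - d))"
      using card_extended_first[OF len len(1), of d t] card_extended_first[OF len(2,1,1), of d t] by simp
  qed
  finally show ?thesis .
qed

lemma first_occ_sums:
  assumes len: "length A = n" "length B = n" and "A \<noteq> B"
  shows "(\<lambda>i. card (first_occ A B i) / 2 ^ (i + n)) sums prob_before A B"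
proof -
  interpret prob_space toss_space by (rule prob_space_toss_space)
  let ?E = "\<lambda>i. {\<omega>. stake (i + n) \<omega> \<in> first_occ A B i}"
  have mem: "\<omega> \<in> ?E i \<longleftrightarrow> occurs_at A \<omega> i \<and> (\<forall>j<i. \<not> occurs_at A \<omega> j \<and> \<not> occurs_at B \<omega> j)" for \<omega> i
    using len by (simp add: first_occ_def strings_def occ_list_stake)
  have "disjoint_family ?E"
    unfolding disjoint_family_on_def
  proof (intro ballI impI equals0I)
    fix i j \<omega> assume "i \<noteq> j" "\<omega> \<in> ?E i \<inter> ?E j"
    then show False unfolding Int_iff mem by (metis nat_neq_iff)
  qed
  moreover have "range ?E \<subseteq> events"
    using stake_event_measurable by auto
  ultimately have "(\<lambda>i. prob (?E i)) sums prob (\<Union>i. ?E i)"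
    by (rule finite_measure_UNION[rotated])
  moreover have "(\<Union>i. ?E i) = {\<omega> \<in> space toss_space. appears_before A B \<omega>}"
  proof (rule set_eqI)
    fix \<omega>
    have "appears_before A B \<omega> \<longleftrightarrow> (\<exists>i. occurs_at A \<omega> i \<and> (\<forall>j<i. \<not> occurs_at A \<omega> j \<and> \<not> occurs_at B \<omega> j))"
    proof
      assume "appears_before A B \<omega>"
      then obtain i where i: "occurs_at A \<omega> i" "\<forall>j\<le>i. \<not> occurs_at B \<omega> j"
        by (auto simp: appears_before_def)
      \<comment> \<open>Any occurrence of \<open>A\<close> ahead of \<open>B\<close> counts for
        \<open>appears_before\<close>; the earliest one makes the events disjoint.\<close>
      let ?m = "LEAST i. occurs_at A \<omega> i"
      have "occurs_at A \<omega> ?m" "?m \<le> i" "\<And>j. j < ?m \<Longrightarrow> \<not> occurs_at A \<omega> j"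
        using i(1) by (auto intro: LeastI Least_le dest: not_less_Least)
      then show "\<exists>i. occurs_at A \<omega> i \<and> (\<forall>j<i. \<not> occurs_at A \<omega> j \<and> \<not> occurs_at B \<omega> j)"
        using i(2) by (meson less_imp_le order_trans)
    next
      assume "\<exists>i. occurs_at A \<omega> i \<and> (\<forall>j<i. \<not> occurs_at A \<omega> j \<and> \<not> occurs_at B \<omega> j)"
      then obtain i where i: "occurs_at A \<omega> i" "\<And>j. j < i \<Longrightarrow> \<not> occurs_at B \<omega> j" by blast
      have "\<not> occurs_at B \<omega> i" using i(1) assms by (auto simp: occurs_at_def)
      with i show "appears_before A B \<omega>"
        unfolding appears_before_def by (metis le_neq_implies_less)
    qed
    then show "\<omega> \<in> (\<Union>i. ?E i) \<longleftrightarrow> \<omega> \<in> {\<omega> \<in> space toss_space. appears_before A B \<omega>}"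
      unfolding UN_iff mem by simp
  qed
  moreover have "prob (?E i) = card (first_occ A B i) / 2 ^ (i + n)" for i
    using len by (intro measure_stake_in) (auto simp: first_occ_def)
  ultimately show ?thesis by (simp add: prob_before_def)
qed

text \<open>The left side is the expected number of tosses until one word is completed, as a sum of
  tail probabilities. Summing \<open>card_avoiders\<close> with weights \<open>1 / 2 ^ t\<close>
  turns each \<open>d\<close> into a delayed copy of the series in \<open>first_occ_sums\<close>
  with factor \<open>2 ^ (n - d)\<close>, and these factors add up to twice a correlation.\<close>

lemma avoiders_sums:
  assumes len: "length A = n" "length B = n" and "A \<noteq> B"
  shows "(\<lambda>t. card (avoiders A B t) / 2 ^ t) sums
    (2 * (correlation A A * prob_before A B + correlation B A * prob_before B A))"
proof -
  define f where "f X Y i = card (first_occ X Y i) / (2 ^ (i + n) :: real)" for X Y i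
  define c where "c X d = of_bool (drop d X = take (n - d) A) * (2 ^ (n - d) :: real)" for X d
  let ?s = "\<lambda>X Y d t. if d \<le> t then f X Y (t - d) else 0"
  have shift: "?s X Y d sums prob_before X Y" if "{X, Y} = {A, B}" for X Y d
  proof -
    have "f X Y sums prob_before X Y"
      unfolding f_def using that assms by (intro first_occ_sums) (auto simp: doubleton_eq_iff)
    then show ?thesis
      using sums_zero_iff_shift[of d "?s X Y d" "prob_before X Y"] by simp
  qed
  have "(\<lambda>t. \<Sum>d<n. c A d * ?s A B d t + c B d * ?s B A d t) sums
      (\<Sum>d<n. c A d * prob_before A B + c B d * prob_before B A)"
    by (intro sums_sum sums_add sums_mult shift) auto
  moreover have "(\<Sum>d<n. c A d * ?s A B d t + c B d * ?s B A d t) = card (avoiders A B t) / 2 ^ t" for t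
  proof -
    have f: "c X d * f X Y (t - d) = of_bool (drop d X = take (n - d) A) * card (first_occ X Y (t - d)) / 2 ^ t"
      if "d < n" "d \<le> t" for X Y d
    proof -
      have "(2::real) ^ (t - d + n) = 2 ^ (n - d) * 2 ^ t"
        using that by (simp flip: power_add)
      then show ?thesis by (simp add: c_def f_def)
    qed
    have "(\<Sum>d<n. c A d * ?s A B d t + c B d * ?s B A d t) =
        (\<Sum>d\<in>{d. d < n \<and> d \<le> t}. c A d * f A B (t - d) + c B d * f B A (t - d))"
      by (intro sum.mono_neutral_cong_right) auto
    also have "\<dots> = card (avoiders A B t) / 2 ^ t"
      unfolding card_avoiders[OF assms] of_nat_sum sum_divide_distrib
      by (intro sum.cong refl) (simp add: f add_divide_distrib)
    finally show ?thesis .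
  qed
  moreover have "(\<Sum>d<n. c X d) = 2 * correlation X A" if "length X = n" for X
    unfolding correlation_def c_def sum_distrib_left that
  proof (intro sum.cong refl)
    fix d assume "d \<in> {..<n}"
    then have "n - d = Suc (n - d - 1)" by auto
    then have "(2::real) ^ (n - d) = 2 * 2 ^ (n - d - 1)" by (metis power_Suc)
    then show "of_bool (drop d X = take (n - d) A) * (2::real) ^ (n - d) =
      2 * (of_bool (drop d X = take (n - d) A) * 2 ^ (n - d - 1))" by simp
  qed
  ultimately show ?thesis
    using len by (simp add: sum.distrib algebra_simps flip: sum_distrib_left)
qed

text \<open>\<open>avoiders\<close> is symmetric in the two words, so appending \<open>B\<close>
  instead of \<open>A\<close> yields a second expression for the same expected waiting time.\<close>

lemma conway_formula:
  assumes "length A = n" "length B = n" "A \<noteq> B"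
  shows "prob_before A B * (correlation A A - correlation A B) =
         prob_before B A * (correlation B B - correlation B A)"
proof -
  have "2 * (correlation A A * prob_before A B + correlation B A * prob_before B A) =
        2 * (correlation B B * prob_before B A + correlation A B * prob_before A B)"
    using avoiders_sums[OF assms] avoiders_sums[of B n A] assms avoiders_commute[of A B]
    by (intro sums_unique2) auto
  then show ?thesis by (simp add: algebra_simps)
qed

text \<open>The probability of seeing neither word within \<open>t\<close> tosses is a term of the
  convergent series in \<open>avoiders_sums\<close>, so it tends to \<open>0\<close> and the game
  ends almost surely.\<close>

lemma prob_before_complement:
  assumes len: "length A = n" "length B = n" and "A \<noteq> B"
  shows "prob_before A B + prob_before B A = 1"
proof -
  interpret prob_space toss_space by (rule prob_space_toss_space)
  let ?E = "\<lambda>A B. {\<omega> \<in> space toss_space. appears_before A B \<omega>}"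
  let ?N = "{\<omega>. \<forall>i. \<not> occurs_at A \<omega> i \<and> \<not> occurs_at B \<omega> i}"
  have E: "?E A B \<in> events" "?E B A \<in> events" by (rule appears_before_measurable)+
  have disj: "?E A B \<inter> ?E B A = {}"
    unfolding appears_before_def by auto (metis linear)
  have N: "?N = space toss_space - (?E A B \<union> ?E B A)"
  proof (intro set_eqI iffI)
    fix \<omega> assume w: "\<omega> \<in> space toss_space - (?E A B \<union> ?E B A)"
    show "\<omega> \<in> ?N"
    proof (rule ccontr)
      assume "\<omega> \<notin> ?N"
      then have ex: "\<exists>i. occurs_at A \<omega> i \<or> occurs_at B \<omega> i" by auto
      define i where "i = (LEAST i. occurs_at A \<omega> i \<or> occurs_at B \<omega> i)"
      have i: "occurs_at A \<omega> i \<or> occurs_at B \<omega> i" "\<And>j. j < i \<Longrightarrow> \<not> occurs_at A \<omega> j \<and> \<not> occurs_at B \<omega> j"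
        using LeastI_ex[OF ex] not_less_Least unfolding i_def by blast+
      have "\<not> (occurs_at A \<omega> i \<and> occurs_at B \<omega> i)"
        using assms by (auto simp: occurs_at_def)
      with i have "appears_before A B \<omega> \<or> appears_before B A \<omega>"
        unfolding appears_before_def by (metis le_neq_implies_less)
      with w show False by auto
    qed
  qed (auto simp: appears_before_def)
  have "prob ?N \<le> card (avoiders A B t) / 2 ^ t" for t
  proof -
    have "prob ?N \<le> prob {\<omega>. stake t \<omega> \<in> avoiders A B t}"
    proof (rule finite_measure_mono)
      show "?N \<subseteq> {\<omega>. stake t \<omega> \<in> avoiders A B t}"
      proof safe
        fix \<omega> assume w: "\<forall>i. \<not> occurs_at A \<omega> i \<and> \<not> occurs_at B \<omega> i"
        have "\<not> occ_list Z (stake t \<omega>) i" if "Z \<in> {A, B}" for Z i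
        proof
          assume o: "occ_list Z (stake t \<omega>) i"
          have "Z \<noteq> []" using that assms by auto
          then have "occurs_at Z \<omega> i"
            using occ_list_length[OF o] occ_list_stake[of i Z t \<omega>] o by simp
          with w that show False by auto
        qed
        then show "stake t \<omega> \<in> avoiders A B t" by (auto simp: avoiders_def strings_def)
      qed
      show "{\<omega>. stake t \<omega> \<in> avoiders A B t} \<in> events" by (rule stake_event_measurable)
    qed
    also have "\<dots> = card (avoiders A B t) / 2 ^ t"
      by (intro measure_stake_in) (auto simp: avoiders_def)
    finally show ?thesis .
  qed
  moreover have "(\<lambda>t. card (avoiders A B t) / 2 ^ t) \<longlonglongrightarrow> 0"
    using avoiders_sums[OF assms] sums_summable summable_LIMSEQ_zero by blast
  ultimately have "prob ?N \<le> 0" by (intro LIMSEQ_le_const) auto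
  then have "prob ?N = 0" using measure_nonneg[of toss_space ?N] by linarith
  moreover have "prob ?N = 1 - prob (?E A B \<union> ?E B A)"
    unfolding N using E by (intro prob_compl) auto
  moreover have "prob (?E A B \<union> ?E B A) = prob (?E A B) + prob (?E B A)"
    using E disj by (intro finite_measure_Union) auto
  ultimately show ?thesis by (simp add: prob_before_def)
qed

section \<open>Optimal first strings\<close>

text \<open>Truncated subtraction makes every \<open>j \<ge> length w\<close> a border, so
  properness has to be stated separately.\<close>

definition border :: "nat \<Rightarrow> 'a list \<Rightarrow> bool" where
  "border j w \<longleftrightarrow> drop (length w - j) w = take j w"

lemma border_0 [simp]: "border 0 w"
  by (simp add: border_def)

lemma border_length [simp]: "border (length w) w"
  by (simp add: border_def)

lemma border_iff_nth:
  assumes "j \<le> length w"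
  shows "border j w \<longleftrightarrow> (\<forall>i<j. w ! (length w - j + i) = w ! i)"
  using assms by (auto simp: border_def list_eq_iff_nth_eq)

lemma correlation_overlap:
  assumes "length X = n"
  shows "correlation X Y = (\<Sum>k<n. of_bool (drop (n - Suc k) X = take (Suc k) Y) * 2 ^ k)"
proof -
  have "correlation X Y = (\<Sum>k<n. of_bool (drop (n - Suc k) X = take (n - (n - Suc k)) Y) * 2 ^ (n - (n - Suc k) - 1))"
    unfolding correlation_def assms by (rule sum.nat_diff_reindex[symmetric])
  also have "\<dots> = (\<Sum>k<n. of_bool (drop (n - Suc k) X = take (Suc k) Y) * 2 ^ k)"
    by (intro sum.cong) auto
  finally show ?thesis .
qed

lemma drop_Suc_nth: "j < length w \<Longrightarrow> drop (length w - Suc j) w = w ! (length w - Suc j) # drop (length w - j) w"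
  using Cons_nth_drop_Suc[of "length w - Suc j" w] by (simp add: Suc_diff_Suc)

text \<open>An overlap of \<open>j + 1\<close> letters, \<open>j < length w\<close>, is a border of
  length \<open>j\<close> of \<open>w\<close> whose prefix copy is followed by \<open>g\<close>.
  Dually, prepending \<open>b\<close> tests the letter in front of the suffix copy.\<close>

lemma correlation_snoc_self:
  "correlation (w @ [g]) (w @ [g]) =
     2 ^ length w + (\<Sum>j<length w. of_bool (border j w \<and> w ! j = g) * 2 ^ j)"
  unfolding correlation_overlap[OF length_append_singleton] sum.lessThan_Suc
  by (auto intro!: sum.cong arg_cong[where f = of_bool] simp: border_def take_Suc_conv_app_nth)

lemma correlation_Cons_self:
  "correlation (b # w) (b # w) =
     2 ^ length w + (\<Sum>j<length w. of_bool (border j w \<and> w ! (length w - Suc j) = b) * 2 ^ j)"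
  unfolding correlation_overlap[OF length_Cons] sum.lessThan_Suc
  by (auto intro!: sum.cong arg_cong[where f = of_bool] simp: border_def drop_Cons' drop_Suc_nth)

text \<open>Both added letters lie outside every overlap except the full one, which the assumption
  excludes.\<close>

lemma correlation_Cons_snoc:
  assumes "b # w \<noteq> w @ [g]"
  shows "correlation (b # w) (w @ [g]) = (\<Sum>j<length w. of_bool (border (Suc j) w) * 2 ^ j)"
  using assms unfolding correlation_overlap[OF length_Cons] sum.lessThan_Suc
  by (auto intro!: sum.cong arg_cong[where f = of_bool] simp: border_def drop_Cons')

lemma correlation_snoc_Cons:
  "correlation (w @ [g]) (b # w) = of_bool (g = b) +
     (\<Sum>j<length w. of_bool (border j w \<and> w ! j = g \<and> w ! (length w - Suc j) = b) * 2 ^ Suc j)"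
  unfolding correlation_overlap[OF length_append_singleton] sum.lessThan_Suc_shift
  by (auto intro!: sum.cong arg_cong[where f = of_bool]
      simp: border_def drop_Suc_nth take_Suc_conv_app_nth)

section \<open>The odds of the answer \<open>b # w\<close> in terms of borders of
  \<open>w\<close>\<close>

definition border_weight :: "coin list \<Rightarrow> coin \<Rightarrow> nat \<Rightarrow> real" where
  "border_weight w g j = of_bool (border j w) + of_bool (border j w \<and> w ! j = g)"

definition letter_sign :: "coin list \<Rightarrow> coin \<Rightarrow> nat \<Rightarrow> real" where
  "letter_sign w b j = (if w ! (length w - Suc j) = b then 1 else - 1)"

text \<open>
  By Conway's formula this is nonpositive iff \<open>b # w\<close> beats \<open>w @ [g]\<close> with odds at least
  \<open>2 : 1\<close>, see \<open>odds_excess_eq\<close>.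
\<close>
definition odds_excess :: "coin list \<Rightarrow> coin \<Rightarrow> coin \<Rightarrow> real" where
  "odds_excess w g b = 1 + of_bool (g = b) +
     (\<Sum>j<length w. 2 ^ j * letter_sign w b j * border_weight w g j)"

lemma odds_excess_eq:
  assumes "b # w \<noteq> w @ [g]"
  shows "2 * (correlation (b # w) (b # w) - correlation (b # w) (w @ [g])) -
    (correlation (w @ [g]) (w @ [g]) - correlation (w @ [g]) (b # w)) = odds_excess w g b"
proof -
  let ?L = "length w"
  \<comment> \<open>Reindexing by border length brings in the empty border, worth \<open>1\<close>,
    and the full one, worth \<open>2 ^ ?L\<close>. The latter cancels against the leading digits of
    the self-correlations.\<close>
  have "2 * correlation (b # w) (w @ [g]) = (\<Sum>j<?L. of_bool (border (Suc j) w) * 2 ^ Suc j)"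
    unfolding correlation_Cons_snoc[OF assms] sum_distrib_left by (intro sum.cong) auto
  also have "\<dots> = (\<Sum>j<Suc ?L. of_bool (border j w) * 2 ^ j) - 1"
    unfolding sum.lessThan_Suc_shift by simp
  also have "\<dots> = (\<Sum>j<?L. of_bool (border j w) * 2 ^ j) + 2 ^ ?L - 1" by simp
  finally have BA: "2 * correlation (b # w) (w @ [g]) = (\<Sum>j<?L. of_bool (border j w) * 2 ^ j) + 2 ^ ?L - 1" .
  \<comment> \<open>For each border this is \<open>2y - 1 - x + 2xy = (2y - 1)(1 + x)\<close>, where
    \<open>x\<close> and \<open>y\<close> are the truth values of \<open>w ! j = g\<close> and
    \<open>w ! (?L - Suc j) = b\<close>.\<close>
  have "(\<Sum>j<?L. 2 ^ j * letter_sign w b j * border_weight w g j) =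
      2 * (\<Sum>j<?L. of_bool (border j w \<and> w ! (?L - Suc j) = b) * 2 ^ j)
      - (\<Sum>j<?L. of_bool (border j w) * 2 ^ j)
      - (\<Sum>j<?L. of_bool (border j w \<and> w ! j = g) * 2 ^ j)
      + (\<Sum>j<?L. of_bool (border j w \<and> w ! j = g \<and> w ! (?L - Suc j) = b) * 2 ^ Suc j)"
    unfolding sum_distrib_left sum_subtractf[symmetric] sum.distrib[symmetric]
    by (intro sum.cong) (auto simp: letter_sign_def border_weight_def)
  then show ?thesis
    unfolding odds_excess_def
    by (simp only: right_diff_distrib BA correlation_Cons_self correlation_snoc_self correlation_snoc_Cons) simp
qed

text \<open>The exceptional words \<open>w\<close>. Equal end letters force the border of length
  \<open>1\<close>, so only longer ones can be forbidden.\<close>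

definition core :: "'a \<Rightarrow> 'a list \<Rightarrow> bool" where
  "core c w \<longleftrightarrow> w ! 0 = c \<and> w ! 1 \<noteq> c \<and> w ! (length w - 2) \<noteq> c \<and> w ! (length w - 1) = c \<and>
     (\<forall>j. 2 \<le> j \<longrightarrow> j < length w \<longrightarrow> \<not> border j w)"

section \<open>Answers that hold Player I to at most one third\<close>

lemma ex_other_coin: "\<exists>b. b \<noteq> (c :: coin)"
  by (cases c) auto

lemma other_coin_eq: "a \<noteq> c \<Longrightarrow> b \<noteq> c \<Longrightarrow> a = (b :: coin)"
  by (cases a; cases b; cases c) auto

lemma border_weight_bounds: "0 \<le> border_weight w g j" "border_weight w g j \<le> 2"
  by (auto simp: border_weight_def)

lemma sum_powers_2: "(\<Sum>j<k. 2 ^ j) = (2::real) ^ k - 1"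
  by (induction k) auto

lemma signed_weight_sum_le: "(\<Sum>j<k. 2 ^ j * letter_sign w b j * border_weight w g j) \<le> 2 * 2 ^ k - 2"
proof -
  have "(\<Sum>j<k. 2 ^ j * letter_sign w b j * border_weight w g j) \<le> (\<Sum>j<k. 2 ^ j * 2)"
    unfolding mult.assoc
    by (intro sum_mono mult_left_mono) (use border_weight_bounds in \<open>auto simp: letter_sign_def\<close>,
      smt (verit) border_weight_bounds)
  then show ?thesis by (simp add: sum_powers_2 flip: sum_distrib_right)
qed

text \<open>The two borders identify the same end of \<open>w\<close> with prefixes shifted by one
  letter, so neighbouring letters of the prefix of length \<open>m\<close> agree.\<close>

lemma border_consecutive_nth:
  assumes "border m w" "border (m - 1) w" "m \<le> length w" "i < m"
  shows "w ! i = w ! 0"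
  using assms(4)
proof (induction i)
  case (Suc i)
  have "w ! (length w - m + Suc i) = w ! Suc i"
    using assms(1) Suc.prems unfolding border_iff_nth[OF assms(3)] by blast
  moreover have "w ! (length w - (m - 1) + i) = w ! i"
    using assms(2,3) Suc.prems border_iff_nth[of "m - 1" w] by simp
  moreover have "length w - m + Suc i = length w - (m - 1) + i"
    using assms Suc.prems by auto
  ultimately show ?case using Suc.IH Suc.prems by (metis Suc_lessD)
qed simp

lemma border_constant:
  assumes "border m w" "m \<le> length w" "\<And>i. i < m \<Longrightarrow> w ! i = c" "j \<le> m"
  shows "border j w" "j < m \<Longrightarrow> w ! (length w - Suc j) = c"
proof -
  have m: "w ! (length w - m + i) = c" if "i < m" for i
    using assms that border_iff_nth[of m w] by auto
  have *: "w ! (length w - j + i) = w ! i" if "i < j" for i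
    using m[of "m - j + i"] assms that by auto
  then show "border j w" using assms border_iff_nth[of j w] by auto
  show "w ! (length w - Suc j) = c" if "j < m"
    using m[of "m - Suc j"] assms that by auto
qed

text \<open>The longest proper border \<open>m\<close> has the largest term, which is negative when
  \<open>b\<close> differs from the letter \<open>e\<close> in front of its suffix copy. This choice
  works unless that border is a run of \<open>g\<close> preceded by another letter and not continued
  by \<open>g\<close>; then the shorter borders decide and \<open>b = e\<close> is right.\<close>

lemma odds_excess_nonpos:
  assumes L: "length w \<ge> 3" and no: "\<And>c. \<not> (core c w \<and> g = c)"
  shows "\<exists>b. odds_excess w g b \<le> 0"
proof -
  let ?L = "length w"
  let ?t = "\<lambda>b j. 2 ^ j * letter_sign w b j * border_weight w g j"
  define m where "m = Max {j. j < ?L \<and> border j w}"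
  have "m \<in> {j. j < ?L \<and> border j w}"
    unfolding m_def using L by (intro Max_in) (auto intro: exI[of _ 0])
  then have m: "m < ?L" "border m w" by auto
  have above: "\<not> border j w" if "m < j" "j < ?L" for j
  proof
    assume "border j w"
    with that have "j \<le> m" unfolding m_def by (intro Max_ge) auto
    with that show False by simp
  qed
  have split: "odds_excess w g b = 1 + of_bool (g = b) + (\<Sum>j<m. ?t b j) + ?t b m" for b
  proof -
    have "(\<Sum>j<?L. ?t b j) = (\<Sum>j<Suc m. ?t b j)"
      by (rule sum.mono_neutral_right) (use m above in \<open>auto simp: border_weight_def\<close>)
    then show ?thesis by (simp add: odds_excess_def)
  qed
  define e where "e = w ! (?L - Suc m)"
  obtain e' where e': "e' \<noteq> e" using ex_other_coin by blast
  have wm: "border_weight w g m = 1 + of_bool (w ! m = g)"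
    using m by (simp add: border_weight_def)
  have tm: "?t e' m = - (2 ^ m * (1 + of_bool (w ! m = g)))"
    using e' by (simp add: letter_sign_def e_def wm)
  show ?thesis
  proof (cases "w ! m = g")
    case True
    \<comment> \<open>The top term \<open>- 2 * 2 ^ m\<close> outweighs the lower terms, at most
      \<open>2 * 2 ^ m - 2\<close>, and the constant, at most \<open>2\<close>.\<close>
    then have "odds_excess w g e' \<le> 0"
      unfolding split tm using signed_weight_sum_le[of w e' g m] by (cases "g = e'") auto
    then show ?thesis by blast
  next
    case nb: False
    show ?thesis
    proof (cases "m = 0")
      case True
      \<comment> \<open>The first and last letters differ, so this \<open>b\<close> also makes the
        only term negative; it equals \<open>- 1\<close> and cancels the constant.\<close>
      define b where "b = w ! 0"
      have "\<not> border 1 w" using above[of 1] True L by auto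
      then have "w ! (?L - 1) \<noteq> w ! 0" using L border_iff_nth[of 1 w] by simp
      then have "odds_excess w g b = 0"
        unfolding split wm using nb True by (auto simp: letter_sign_def b_def border_weight_def)
      then show ?thesis by (metis order_refl)
    next
      case m0: False
      show ?thesis
      proof (cases "border (m - 1) w")
        case False
        then have m2: "m \<ge> 2" using m0 by (cases "m = 1") auto
        \<comment> \<open>With no border of length \<open>m - 1\<close> the lower terms give at most
          \<open>2 ^ m - 2\<close>, so a top term of only \<open>- (2 ^ m)\<close> suffices.\<close>
        define k where "k = m - 1"
        have k: "m = Suc k" "border_weight w g k = 0"
          using False m2 by (auto simp: k_def border_weight_def)
        have "odds_excess w g e' \<le> 0"
          unfolding split tm using signed_weight_sum_le[of w e' g k] nb k by (cases "g = e'") auto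
        then show ?thesis by blast
      next
        case True
        define c where "c = w ! 0"
        have const: "w ! i = c" if "i < m" for i
          unfolding c_def by (rule border_consecutive_nth[OF m(2) True _ that]) (use m in simp)
        have bd: "border j w" if "j \<le> m" for j
          using border_constant(1)[OF m(2) _ const that] m by auto
        have lst: "w ! (?L - Suc j) = c" if "j < m" for j
          using border_constant(2)[OF m(2) _ const _ that] m that by auto
        have wj: "border_weight w g j = 1 + of_bool (c = g)" if "j < m" for j
          using bd[of j] const[of j] that by (simp add: border_weight_def)
        \<comment> \<open>All borders below \<open>m\<close> are present with equal sign and weight:
          a geometric sum.\<close>
        have tb: "(\<Sum>j<m. ?t b j) = (if c = b then 1 else - 1) * (1 + of_bool (c = g)) * (2 ^ m - 1)" for b
        proof -
          have "(\<Sum>j<m. ?t b j) = (\<Sum>j<m. 2 ^ j * ((if c = b then 1 else - 1) * (1 + of_bool (c = g))))"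
            by (intro sum.cong) (auto simp: wj letter_sign_def lst)
          then show ?thesis by (simp add: sum_powers_2 flip: sum_distrib_right)
        qed
        have pm: "(2::real) ^ m \<ge> 2" using m0 self_le_power[of "2::real" m] by auto
        show ?thesis
        proof (cases "e = c")
          case True
          then have "odds_excess w g e' \<le> 0"
            unfolding split tm tb using nb e' pm by auto
          then show ?thesis by blast
        next
          case ec: False
          show ?thesis
          proof (cases "g = c")
            case False
            have "e' = c" using other_coin_eq[of e' e c] e' ec by auto
            then have "odds_excess w g e' \<le> 0"
              unfolding split tm tb using nb False by auto
            then show ?thesis by blast
          next
            case gc: True
            have "m \<noteq> 1"
            proof
              assume m1: "m = 1"
              have "core c w"
                unfolding core_def using above m1 nb gc ec lst[of 0] const[of 0]
                by (auto simp: e_def numeral_2_eq_2)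
              then show False using no gc by blast
            qed
            then have "2 \<le> m" using m0 by auto
            then have pm: "(2::real) ^ m \<ge> 2 ^ 2" by (intro power_increasing) auto
            \<comment> \<open>The top term is now positive, but the total is
              \<open>1 - 2 * (2 ^ m - 1) + 2 ^ m = 3 - 2 ^ m\<close>.\<close>
            have te: "?t e m = 2 ^ m" using nb by (simp add: wm letter_sign_def e_def)
            have "odds_excess w g e \<le> 0"
              unfolding split te tb using ec gc pm by simp
            then show ?thesis by blast
          qed
        qed
      qed
    qed
  qed
qed

text \<open>Equality of the words makes \<open>w\<close> constant, so no term is negative. Hence a
  nonpositive excess certifies that \<open>b # w\<close> is a legal answer.\<close>

lemma odds_excess_pos_if_eq:
  assumes "b # w = w @ [g]"
  shows "odds_excess w g b \<ge> 1"
proof -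
  have "w ! i = b" if "i < length w" for i
    using that
  proof (induction i)
    case 0
    have "(b # w) ! 0 = (w @ [g]) ! 0" using assms by simp
    then show ?case using 0 by (simp add: nth_append)
  next
    case (Suc i)
    have "(b # w) ! Suc i = (w @ [g]) ! Suc i" using assms by simp
    then have "w ! i = w ! Suc i" using Suc.prems by (simp add: nth_append)
    then show ?case using Suc by simp
  qed
  then have "(\<Sum>j<length w. 2 ^ j * letter_sign w b j * border_weight w g j) \<ge> 0"
    by (intro sum_nonneg mult_nonneg_nonneg) (auto simp: letter_sign_def border_weight_bounds)
  then show ?thesis by (simp add: odds_excess_def)
qed

lemma correlation_nonneg: "correlation X Y \<ge> 0"
  unfolding correlation_def by (intro sum_nonneg) auto

lemma correlation_self_ge: "X \<noteq> [] \<Longrightarrow> correlation X X \<ge> 2 ^ (length X - 1)"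
  using member_le_sum[of 0 "{..<length X}"
      "\<lambda>d. of_bool (drop d X = take (length X - d) X) * (2 ^ (length X - d - 1) :: real)"]
  by (simp add: correlation_def del: sum_of_bool_mult_eq)

lemma correlation_le:
  assumes "length X = n" "m \<le> n"
    and "\<And>k. m < k \<Longrightarrow> k \<le> n \<Longrightarrow> drop (n - k) X \<noteq> take k Y"
  shows "correlation X Y \<le> 2 ^ m - 1"
proof -
  have "correlation X Y = (\<Sum>k<m. of_bool (drop (n - Suc k) X = take (Suc k) Y) * 2 ^ k)"
    unfolding correlation_overlap[OF assms(1)]
    by (rule sum.mono_neutral_right) (use assms in auto)
  also have "\<dots> \<le> (\<Sum>k<m. 2 ^ k)"
    by (intro sum_mono) auto
  finally show ?thesis by (simp add: sum_powers_2)
qed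

text \<open>As \<open>A \<noteq> B\<close>, the leading digit is present in
  \<open>correlation B B\<close> but missing in \<open>correlation B A\<close>.\<close>

lemma correlation_diff_pos:
  assumes "length A = Suc l" "length B = Suc l" "A \<noteq> B"
  shows "correlation B B - correlation B A > 0"
proof -
  have "correlation B A \<le> 2 ^ l - 1"
  proof (rule correlation_le)
    fix k assume "l < k" "k \<le> Suc l"
    then have "k = Suc l" by simp
    then show "drop (Suc l - k) B \<noteq> take k A" using assms by simp
  qed (use assms in auto)
  moreover have "correlation B B \<ge> 2 ^ l"
    using correlation_self_ge[of B] assms by (cases B) auto
  ultimately show ?thesis by simp
qed

lemma prob_before_le_third:
  assumes "odds_excess w g b \<le> 0"
  shows "b # w \<noteq> w @ [g]" "prob_before (w @ [g]) (b # w) \<le> 1 / 3"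
proof -
  show ne: "b # w \<noteq> w @ [g]"
    using odds_excess_pos_if_eq[of b w g] assms by auto
  let ?A = "w @ [g]" and ?B = "b # w"
  define N D where "N = correlation ?A ?A - correlation ?A ?B" "D = correlation ?B ?B - correlation ?B ?A"
  define p q where "p = prob_before ?A ?B" "q = prob_before ?B ?A"
  have D: "D > 0" unfolding N_D_def using ne by (intro correlation_diff_pos[of _ "length w"]) auto
  have "p * N = q * D" unfolding N_D_def p_q_def
    using ne by (intro conway_formula[of _ "Suc (length w)"]) auto
  moreover have "p * (2 * D) \<le> p * N"
    using odds_excess_eq[OF ne] assms unfolding N_D_def p_q_def
    by (intro mult_left_mono) (auto simp: prob_before_def)
  ultimately have "D * (2 * p) \<le> D * q" by (simp add: mult_ac)
  then have "2 * p \<le> q" using D by simp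
  moreover have "p + q = 1" unfolding p_q_def
    using ne by (intro prob_before_complement[of _ "Suc (length w)"]) auto
  ultimately show "p \<le> 1 / 3" by simp
qed

section \<open>The exact guarantee of the exceptional words\<close>

context
  fixes c :: coin and w :: "coin list"
  assumes core: "core c w" and len: "length w \<ge> 3"
begin

lemma core_border_iff: "j < length w \<Longrightarrow> border j w \<longleftrightarrow> j \<le> 1"
proof -
  have "border 1 w" using core len border_iff_nth[of 1 w] by (simp add: core_def)
  then show "border j w \<longleftrightarrow> j \<le> 1" if "j < length w"
    using core that unfolding core_def by (metis border_0 less_one not_less_eq_eq numeral_2_eq_2 One_nat_def le_neq_implies_less)
qed

lemma core_sum:
  "(\<Sum>j<length w. of_bool (border j w \<and> P j) * f j) = of_bool (P 0) * f 0 + (of_bool (P 1) * f 1 :: real)"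
proof -
  have "(\<Sum>j<length w. of_bool (border j w \<and> P j) * f j) = (\<Sum>j\<in>{0, 1}. of_bool (border j w \<and> P j) * f j)"
    by (rule sum.mono_neutral_right) (use len core_border_iff in auto)
  also have "\<dots> = of_bool (P 0) * f 0 + of_bool (P 1) * f 1"
    using core_border_iff[of 1] len by simp
  finally show ?thesis .
qed

lemma core_nth: "w ! 0 = c" "w ! 1 \<noteq> c" "w ! (length w - Suc 0) = c" "w ! (length w - Suc 1) \<noteq> c"
  using core unfolding core_def numeral_2_eq_2 One_nat_def by blast+

lemma core_ne: "b # w \<noteq> w @ [c]"
proof
  assume "b # w = w @ [c]"
  then have "(b # w) ! 0 = (w @ [c]) ! 0" "(b # w) ! 1 = (w @ [c]) ! 1" by auto
  then show False using core_nth len by (simp add: nth_append)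
qed

lemma core_correlation:
  "correlation (w @ [c]) (w @ [c]) = 2 ^ length w + 1"
  "correlation (w @ [c]) (b # w) = (if b = c then 3 else 0)"
  "correlation (b # w) (b # w) = 2 ^ length w + (if b = c then 1 else 2)"
  "correlation (b # w) (w @ [c]) = 2 ^ (length w - 1) + 1"
proof -
  have b: "b \<noteq> c \<Longrightarrow> w ! (length w - Suc 1) = b"
    using core_nth other_coin_eq by blast
  show "correlation (w @ [c]) (w @ [c]) = 2 ^ length w + 1"
    unfolding correlation_snoc_self core_sum using core_nth by simp
  show "correlation (w @ [c]) (b # w) = (if b = c then 3 else 0)"
    unfolding correlation_snoc_Cons core_sum using core_nth by simp
  show "correlation (b # w) (b # w) = 2 ^ length w + (if b = c then 1 else 2)"
    unfolding correlation_Cons_self core_sum using core_nth b by auto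
  have "correlation (b # w) (w @ [c]) = (\<Sum>j\<in>{0, length w - 1}. of_bool (border (Suc j) w) * 2 ^ j)"
    unfolding correlation_Cons_snoc[OF core_ne]
  proof (rule sum.mono_neutral_right)
    show "\<forall>j\<in>{..<length w} - {0, length w - 1}. of_bool (border (Suc j) w) * 2 ^ j = (0::real)"
      using core_border_iff by (auto simp: less_diff_conv) 
  qed (use len in auto)
  also have "\<dots> = of_bool (border (Suc 0) w) * 2 ^ 0 + of_bool (border (Suc (length w - 1)) w) * 2 ^ (length w - 1)"
    using len by (simp del: sum_of_bool_mult_eq)
  also have "\<dots> = 2 ^ (length w - 1) + 1"
  proof -
    have "Suc (length w - 1) = length w" using len by simp
    then show ?thesis using len core_border_iff[of 1] by simp
  qed
  finally show "correlation (b # w) (w @ [c]) = 2 ^ (length w - 1) + 1" .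
qed

text \<open>Equality holds for \<open>B = b # w\<close> with \<open>b \<noteq> c\<close>. An answer
  not ending in \<open>w\<close> loses the two longest overlaps with \<open>w @ [c]\<close>, so its
  own difference is at least \<open>x + 1\<close>, while the other one is at most
  \<open>2 * x + 1\<close>.\<close>

lemma core_odds_bound:
  defines "x \<equiv> 2 ^ (length w - 1)"
  assumes B: "length B = Suc (length w)" "B \<noteq> w @ [c]"
  shows "(correlation (w @ [c]) (w @ [c]) - correlation (w @ [c]) B) * (x + 1) \<le>
    (2 * x + 1) * (correlation B B - correlation B (w @ [c]))"
proof -
  have x: "2 ^ length w = 2 * x" unfolding x_def using len by (cases "length w") auto
  have x1: "x \<ge> 1" by (simp add: x_def)
  show ?thesis
  proof (cases "tl B = w")
    case True
    then obtain b where b: "B = b # w" using B(1) by (cases B) auto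
    have "x * x \<ge> 0" by simp
    then show ?thesis
      unfolding b core_correlation x x_def[symmetric] using x1
      by (auto simp: algebra_simps)
  next
    case False
    have "correlation B (w @ [c]) \<le> 2 ^ (length w - 1) - 1"
    proof (rule correlation_le)
      fix k assume "length w - 1 < k" "k \<le> Suc (length w)"
      then have "k = length w \<or> k = Suc (length w)" by auto
      then show "drop (Suc (length w) - k) B \<noteq> take k (w @ [c])"
        using B False by (auto simp: drop_Suc)
    qed (use B in auto)
    moreover have "correlation B B \<ge> 2 * x"
      using correlation_self_ge[of B] B by (cases B) (auto simp flip: x)
    ultimately have "correlation B B - correlation B (w @ [c]) \<ge> x + 1"
      by (simp add: x_def)
    moreover have "correlation (w @ [c]) (w @ [c]) - correlation (w @ [c]) B \<le> 2 * x + 1"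
      using correlation_nonneg[of "w @ [c]" B] by (simp add: core_correlation x)
    ultimately show ?thesis
      using x1 by (smt (verit) mult_left_mono mult_right_mono)
  qed
qed

lemma core_guaranteed_prob:
  defines "x \<equiv> 2 ^ (length w - 1)"
  shows "guaranteed_prob (Suc (length w)) (w @ [c]) = (x + 1) / (3 * x + 2)"
  unfolding guaranteed_prob_def
proof (rule Min_eqI)
  let ?A = "w @ [c]"
  have x1: "x \<ge> 1" by (simp add: x_def)
  have x: "2 ^ length w = 2 * x" unfolding x_def using len by (cases "length w") auto
  show "finite (prob_before ?A ` (strings (Suc (length w)) - {?A}))" by simp
  fix p assume "p \<in> prob_before ?A ` (strings (Suc (length w)) - {?A})"
  then obtain B where B: "length B = Suc (length w)" "B \<noteq> ?A" and p: "p = prob_before ?A B"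
    by (auto simp: strings_def)
  define q where "q = prob_before B ?A"
  define N D where "N = correlation ?A ?A - correlation ?A B" "D = correlation B B - correlation B ?A"
  have pq: "p + q = 1" unfolding p q_def
    using B by (intro prob_before_complement[of _ "Suc (length w)"]) auto
  have "p * N = q * D" unfolding N_D_def p q_def
    using B by (intro conway_formula[of _ "Suc (length w)"]) auto
  moreover have "p * (N * (x + 1)) \<le> p * ((2 * x + 1) * D)"
    using core_odds_bound[OF B] unfolding N_D_def p x_def
    by (intro mult_left_mono) (auto simp: prob_before_def)
  ultimately have "D * (q * (x + 1)) \<le> D * (p * (2 * x + 1))"
    by (metis mult.assoc mult.commute)
  moreover have "D > 0"
    unfolding N_D_def using B by (intro correlation_diff_pos[of _ "length w"]) auto
  ultimately have "q * (x + 1) \<le> p * (2 * x + 1)" by simp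
  moreover have "q = 1 - p" using pq by simp
  ultimately show "(x + 1) / (3 * x + 2) \<le> p"
    using x1 by (simp add: field_simps)
next
  let ?A = "w @ [c]"
  \<comment> \<open>The minimum is attained at this \<open>b # w\<close>, whose odds are exactly
    \<open>2 * x + 1\<close> to \<open>x + 1\<close>.\<close>
  obtain b where b: "b \<noteq> c" using ex_other_coin by blast
  have x1: "x \<ge> 1" by (simp add: x_def)
  have x: "2 ^ length w = 2 * x" unfolding x_def using len by (cases "length w") auto
  define p q where "p = prob_before ?A (b # w)" "q = prob_before (b # w) ?A"
  have "p + q = 1" unfolding p_q_def
    by (rule prob_before_complement[OF _ _ core_ne[symmetric]]) simp_all
  then have q: "q = 1 - p" by simp
  have "p * (2 * x + 1) = (1 - p) * (x + 1)"
    using conway_formula[OF _ _ core_ne[of b, symmetric], of "Suc (length w)"] b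
    unfolding core_correlation x x_def[symmetric] p_q_def[symmetric] q by simp
  then have "p * (3 * x + 2) = x + 1" by (simp add: algebra_simps)
  then have "p = (x + 1) / (3 * x + 2)"
    using x1 by (simp add: eq_divide_eq)
  then show "(x + 1) / (3 * x + 2) \<in> prob_before ?A ` (strings (Suc (length w)) - {?A})"
    unfolding p_q_def using core_ne[of b] by (intro image_eqI[of _ _ "b # w"]) (auto simp: strings_def)
qed

end

section \<open>The set of optimal words\<close>

lemma non_core_guaranteed_prob:
  assumes "length w \<ge> 3" "\<not> core g w"
  shows "guaranteed_prob (Suc (length w)) (w @ [g]) \<le> 1 / 3"
proof -
  obtain b where b: "odds_excess w g b \<le> 0"
    using odds_excess_nonpos[of w g] assms by blast
  have "guaranteed_prob (Suc (length w)) (w @ [g]) \<le> prob_before (w @ [g]) (b # w)"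
    unfolding guaranteed_prob_def
    using prob_before_le_third(1)[OF b] by (intro Min_le finite_imageI finite_Diff finite_strings imageI) (auto simp: strings_def)
  also have "\<dots> \<le> 1 / 3" by (rule prob_before_le_third(2)[OF b])
  finally show ?thesis .
qed

text \<open>A border of length at least \<open>2\<close> in \<open>c b ... b c\<close> would put
  \<open>c\<close> on an inner position. Existence ensures that a guarantee above
  \<open>1 / 3\<close> is really reached.\<close>

lemma core_exists:
  assumes "L \<ge> 3"
  shows "\<exists>w. length w = L \<and> core (c :: coin) w"
proof -
  obtain b where b: "b \<noteq> c" using ex_other_coin by blast
  define w where "w = c # replicate (L - 2) b @ [c]"
  have len: "length w = L" using assms by (simp add: w_def)
  have mid: "w ! i = b" if "1 \<le> i" "i < L - 1" for i
    using that by (auto simp: w_def nth_Cons' nth_append)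
  have last: "w ! (L - 1) = c" using assms by (auto simp: w_def nth_Cons' nth_append)
  have "\<not> border j w" if "2 \<le> j" "j < L" for j
  proof
    assume "border j w"
    then have "\<forall>i<j. w ! (L - j + i) = w ! i" using border_iff_nth[of j w] len that by simp
    from this[rule_format, of 0] have "w ! (L - j) = c" using that by (simp add: w_def)
    moreover have "w ! (L - j) = b" using that by (intro mid) auto
    ultimately show False using b by simp
  qed
  then have "core c w"
    unfolding core_def len using mid[of 1] mid[of "L - 2"] last b assms by (simp add: w_def)
  with len show ?thesis by blast
qed

lemma optimal_strategies_eq:
  assumes "L \<ge> 3"
  shows "optimal_strategies (Suc L) = {w @ [c] |w c. length w = L \<and> core c w}"
proof -
  let ?v = "(2 ^ (L - 1) + 1) / (3 * 2 ^ (L - 1) + 2) :: real"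
  let ?g = "guaranteed_prob (Suc L)"
  have strings: "A \<in> strings (Suc L) \<longleftrightarrow> (\<exists>w c. A = w @ [c] \<and> length w = L)" for A
    by (auto simp: strings_def length_Suc_conv_rev)
  have v: "1 / 3 < ?v" by (simp add: field_simps add_pos_pos)
  have core: "?g (w @ [c]) = ?v" if "length w = L" "core c w" for w c
    using core_guaranteed_prob[OF that(2)] that assms by simp
  have non_core: "?g (w @ [c]) \<le> 1 / 3" if "length w = L" "\<not> core c w" for w c
    using non_core_guaranteed_prob[OF _ that(2)] that assms by simp
  obtain w0 where w0: "length w0 = L" "core Heads w0" using core_exists[OF assms] by blast
  have le: "?g A \<le> ?v" if "A \<in> strings (Suc L)" for A
    using that core non_core v unfolding strings by (metis less_imp_le order_trans order_refl)
  show ?thesis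
  proof (intro set_eqI iffI)
    fix A assume A: "A \<in> optimal_strategies (Suc L)"
    then obtain w c where w: "A = w @ [c]" "length w = L"
      unfolding optimal_strategies_def strings by blast
    have "w0 @ [Heads] \<in> strings (Suc L)" using w0 strings by blast
    then have "?v \<le> ?g A" using A core[OF w0] by (auto simp: optimal_strategies_def)
    then have "\<not> ?g (w @ [c]) \<le> 1 / 3" using v unfolding w(1) by linarith
    then have "core c w" using non_core[of w c] w by blast
    with w show "A \<in> {w @ [c] |w c. length w = L \<and> core c w}" by blast
  next
    fix A :: "coin list" assume "A \<in> {w @ [c] |w c. length w = L \<and> core c w}"
    then obtain w c where w: "A = w @ [c]" "length w = L" "core c w" by blast
    then have "A \<in> strings (Suc L)" using strings by blast
    then show "A \<in> optimal_strategies (Suc L)"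
      using le core[OF w(2,3)] w(1) by (simp add: optimal_strategies_def)
  qed
qed

section \<open>The recurrence\<close>

text \<open>Two occurrences of a border longer than half the word overlap in a shorter border.\<close>
lemma border_shorter:
  assumes "border j w" "j \<le> length w" "length w \<le> 2 * j"
  shows "border (2 * j - length w) w"
proof -
  let ?k = "length w - j"
  have "length w - (2 * j - length w) = ?k + ?k" using assms by auto
  then have "drop (length w - (2 * j - length w)) w = drop ?k (drop ?k w)" by simp
  also have "\<dots> = take (j - ?k) (drop ?k w)"
    using assms(1) by (simp add: border_def drop_take)
  also have "\<dots> = take (2 * j - length w) w"
    using assms by (simp add: border_def mult_2)
  finally show ?thesis by (simp add: border_def)
qed

text \<open>Iterates \<open>border_shorter\<close> until the two copies share at most one letter.
  The \<open>+ 1\<close> is there because a shared part of one letter only gives a border of length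
  \<open>1\<close>, which is allowed.\<close>

lemma ex_short_border:
  assumes "border j w" "2 \<le> j" "j < length w"
  shows "\<exists>i. 2 \<le> i \<and> 2 * i \<le> length w + 1 \<and> border i w"
  using assms
proof (induction j rule: less_induct)
  case (less j)
  show ?case
  proof (cases "2 * j \<le> length w + 1")
    case False
    then have "border (2 * j - length w) w"
      using less.prems by (intro border_shorter) auto
    then show ?thesis using less.IH[of "2 * j - length w"] less.prems False by auto
  qed (use less.prems in blast)
qed

lemma core_iff_short:
  assumes "length w \<ge> 2"
  shows "core c w \<longleftrightarrow> w ! 0 = c \<and> w ! 1 \<noteq> c \<and> w ! (length w - 2) \<noteq> c \<and> w ! (length w - 1) = c \<and>
    (\<forall>j. 2 \<le> j \<and> 2 * j \<le> length w + 1 \<longrightarrow> \<not> border j w)"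
proof -
  have "(\<forall>j. 2 \<le> j \<longrightarrow> j < length w \<longrightarrow> \<not> border j w) \<longleftrightarrow>
    (\<forall>j. 2 \<le> j \<and> 2 * j \<le> length w + 1 \<longrightarrow> \<not> border j w)"
  proof (intro iffI allI impI notI)
    fix j assume "\<forall>j. 2 \<le> j \<longrightarrow> j < length w \<longrightarrow> \<not> border j w" "2 \<le> j \<and> 2 * j \<le> length w + 1" "border j w"
    moreover from this have "j < length w" by linarith
    ultimately show False by blast
  qed (use ex_short_border[of _ w] in blast)
  then show ?thesis unfolding core_def by blast
qed

section \<open>Cutting cores in the middle\<close>

definition cores :: "coin \<Rightarrow> nat \<Rightarrow> coin list set" where
  "cores c L = {w. length w = L \<and> core c w}"

text \<open>
  Inserting letters between \<open>u\<close> and \<open>v\<close> does not affect borders of length at most \<open>h\<close>,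
  and the shortest forbidden border overlaps itself in at most one letter. Hence going from
  \<open>u @ v\<close> to \<open>u @ [x] @ v\<close>, or to \<open>u @ [x, y] @ v\<close>, can only create a border of length
  \<open>h + 1\<close>.
\<close>
definition halves :: "coin \<Rightarrow> nat \<Rightarrow> (coin list \<times> coin list) set" where
  "halves c h = {(u, v). length u = h \<and> length v = h \<and> u ! 0 = c \<and> u ! 1 \<noteq> c \<and>
     v ! (h - 2) \<noteq> c \<and> v ! (h - 1) = c \<and>
     (\<forall>j. 2 \<le> j \<and> j \<le> h \<longrightarrow> drop (h - j) v \<noteq> take j u)}"

lemma finite_cores [simp]: "finite (cores c L)"
  by (rule finite_subset[OF _ finite_strings[of L]]) (auto simp: cores_def strings_def)

lemma finite_halves [simp]: "finite (halves c h)"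
  by (rule finite_subset[OF _ finite_cartesian_product[OF finite_strings[of h] finite_strings[of h]]])
    (auto simp: halves_def strings_def)

lemma UNIV_coin: "(UNIV :: coin set) = {Heads, Tails}"
  by (auto intro: coin.exhaust)

lemma finite_coin: "finite (UNIV :: coin set)"
  by (simp add: UNIV_coin)

lemma all_le_Suc_iff:
  assumes "m \<le> Suc h"
  shows "(\<forall>j. m \<le> j \<and> j \<le> Suc h \<longrightarrow> P j) \<longleftrightarrow> (\<forall>j. m \<le> j \<and> j \<le> h \<longrightarrow> P j) \<and> P (Suc h)"
  using assms by (auto simp: le_Suc_eq)

lemma core_append_iff:
  assumes "length u = h" "length v = h" "h \<ge> 2"
  shows "core c (u @ v) \<longleftrightarrow> (u, v) \<in> halves c h"
proof -
  have "border j (u @ v) \<longleftrightarrow> drop (h - j) v = take j u" if "j \<le> h" for j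
    using assms that by (simp add: border_def)
  then show ?thesis
    using assms by (auto simp: core_iff_short halves_def nth_append)
qed

text \<open>By \<open>core_iff_short\<close> the only border length to test beyond \<open>h\<close>
  is \<open>h + 1\<close>, whose two copies share the middle letter \<open>x\<close>.\<close>

lemma core_append_Cons_iff:
  assumes "length u = h" "length v = h" "h \<ge> 2"
  shows "core c (u @ x # v) \<longleftrightarrow> (u, v) \<in> halves c h \<and> u @ [x] \<noteq> x # v"
proof -
  have b: "border j (u @ x # v) \<longleftrightarrow> drop (h - j) v = take j u" if "j \<le> h" for j
    using assms that by (simp add: border_def Suc_diff_le)
  have b': "border (Suc h) (u @ x # v) \<longleftrightarrow> x # v = u @ [x]"
    using assms by (simp add: border_def)
  have "(\<forall>j. 2 \<le> j \<and> 2 * j \<le> length (u @ x # v) + 1 \<longrightarrow> \<not> border j (u @ x # v)) \<longleftrightarrow>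
    (\<forall>j. 2 \<le> j \<and> j \<le> h \<longrightarrow> drop (h - j) v \<noteq> take j u) \<and> x # v \<noteq> u @ [x]"
  proof -
    have "2 * j \<le> length (u @ x # v) + 1 \<longleftrightarrow> j \<le> h \<or> j = Suc h" for j
      using assms by auto
    then show ?thesis using b b' assms(3) by auto
  qed
  moreover have "(u @ x # v) ! (length (u @ x # v) - 1) = v ! (h - 1)"
    "(u @ x # v) ! (length (u @ x # v) - 2) = v ! (h - 2)"
    using assms by (auto simp: nth_append nth_Cons' numeral_2_eq_2)
  ultimately show ?thesis
    using assms by (auto simp: core_iff_short halves_def nth_append)
qed

lemma snoc_Cons_in_halves_iff:
  assumes "length u = h" "length v = h" "h \<ge> 2"
  shows "(u @ [x], y # v) \<in> halves c (Suc h) \<longleftrightarrow> (u, v) \<in> halves c h \<and> u @ [x] \<noteq> y # v"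
proof -
  have "(\<forall>j. 2 \<le> j \<and> j \<le> Suc h \<longrightarrow> drop (Suc h - j) (y # v) \<noteq> take j (u @ [x])) \<longleftrightarrow>
    (\<forall>j. 2 \<le> j \<and> j \<le> h \<longrightarrow> drop (h - j) v \<noteq> take j u) \<and> y # v \<noteq> u @ [x]"
  proof -
    have "drop (Suc h - j) (y # v) = drop (h - j) v" "take j (u @ [x]) = take j u" if "j \<le> h" for j
      using assms that by (simp_all add: Suc_diff_le)
    then have "(\<forall>j. 2 \<le> j \<and> j \<le> h \<longrightarrow> drop (Suc h - j) (y # v) \<noteq> take j (u @ [x])) \<longleftrightarrow>
      (\<forall>j. 2 \<le> j \<and> j \<le> h \<longrightarrow> drop (h - j) v \<noteq> take j u)"
      by (intro iff_allI imp_cong refl) simp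
    moreover have "2 \<le> Suc h" using assms by simp
    ultimately show ?thesis using assms by (simp add: all_le_Suc_iff)
  qed
  moreover have "(y # v) ! (Suc h - 1) = v ! (h - 1)" "(y # v) ! (Suc h - 2) = v ! (h - 2)"
    using assms by (auto simp: nth_Cons' numeral_2_eq_2)
  ultimately show ?thesis
    using assms by (auto simp: halves_def nth_append)
qed

text \<open>This counts the failing insertions: if \<open>u @ [x]\<close> and \<open>y # v\<close>
  are the same word \<open>t\<close>, then \<open>u = butlast t\<close> and \<open>v = tl t\<close>,
  and they contain both copies of every proper border of \<open>t\<close>.\<close>

lemma butlast_tl_in_halves_iff:
  assumes "length t = Suc h" "h \<ge> 2"
  shows "(butlast t, tl t) \<in> halves c h \<longleftrightarrow> core c t"
proof -
  have "border j t \<longleftrightarrow> drop (h - j) (tl t) = take j (butlast t)" if "j \<le> h" for j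
  proof -
    have "drop (h - j) (tl t) = drop (Suc h - j) t"
      using that by (simp add: Suc_diff_le drop_Suc)
    then show ?thesis
      using assms that by (simp add: border_def take_butlast)
  qed
  then have "(\<forall>j. 2 \<le> j \<longrightarrow> j < length t \<longrightarrow> \<not> border j t) \<longleftrightarrow>
    (\<forall>j. 2 \<le> j \<and> j \<le> h \<longrightarrow> drop (h - j) (tl t) \<noteq> take j (butlast t))"
    using assms(1) by (auto simp: less_Suc_eq_le)
  moreover have "butlast t ! 0 = t ! 0" "butlast t ! 1 = t ! 1"
    "tl t ! (h - 2) = t ! (length t - 2)" "tl t ! (h - 1) = t ! (length t - 1)"
    using assms by (auto simp: nth_butlast nth_tl Suc_diff_Suc numeral_2_eq_2)
  ultimately show ?thesis
    using assms(1) unfolding core_def halves_def by simp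
qed

section \<open>Counting cores by inserting letters\<close>

lemma card_cores_even:
  assumes "h \<ge> 2"
  shows "card (cores c (2 * h)) = card (halves c h)"
proof -
  have "bij_betw (\<lambda>(u, v). u @ v) (halves c h) (cores c (2 * h))"
  proof (rule bij_betw_byWitness[where f' = "\<lambda>w. (take h w, drop h w)"])
    show "(\<lambda>w. (take h w, drop h w)) ` cores c (2 * h) \<subseteq> halves c h"
    proof (rule image_subsetI)
      fix w assume "w \<in> cores c (2 * h)"
      then show "(take h w, drop h w) \<in> halves c h"
        using core_append_iff[OF _ _ assms, of "take h w" "drop h w" c] by (simp add: cores_def)
    qed
    show "(\<lambda>(u, v). u @ v) ` halves c h \<subseteq> cores c (2 * h)"
    proof safe
      fix u v assume uv: "(u, v) \<in> halves c h"
      then have "length u = h" "length v = h" by (auto simp: halves_def)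
      then show "u @ v \<in> cores c (2 * h)"
        using core_append_iff[OF _ _ assms] uv by (auto simp: cores_def)
    qed
  qed (auto simp: halves_def)
  from bij_betw_same_card[OF this] show ?thesis by simp
qed

definition overlaps :: "coin \<Rightarrow> nat \<Rightarrow> ((coin list \<times> coin list) \<times> coin \<times> coin) set" where
  "overlaps c h = {((u, v), x, y). (u, v) \<in> halves c h \<and> u @ [x] = y # v}"

lemma card_overlaps:
  assumes "h \<ge> 2"
  shows "card (overlaps c h) = card (cores c (h + 1))"
proof -
  have "bij_betw (\<lambda>((u, v), x, y). u @ [x]) (overlaps c h) (cores c (h + 1))"
  proof (rule bij_betw_byWitness[where f' = "\<lambda>t. ((butlast t, tl t), last t, hd t)"])
    show "(\<lambda>((u, v), x, y). u @ [x]) ` overlaps c h \<subseteq> cores c (h + 1)"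
    proof (rule image_subsetI)
      fix p assume p: "p \<in> overlaps c h"
      obtain u v x y where uvxy: "p = ((u, v), x, y)" by (metis surj_pair)
      then have uv: "(u, v) \<in> halves c h" "u @ [x] = y # v" using p by (auto simp: overlaps_def)
      have "length (u @ [x]) = Suc h" using uv(1) by (auto simp: halves_def)
      moreover have "tl (u @ [x]) = v" unfolding uv(2) by simp
      ultimately have "core c (u @ [x])"
        using butlast_tl_in_halves_iff[of "u @ [x]" h c] uv(1) assms by (simp only: butlast_snoc)
      then show "(\<lambda>((u, v), x, y). u @ [x]) p \<in> cores c (h + 1)"
        using \<open>length (u @ [x]) = Suc h\<close> uvxy by (simp add: cores_def)
    qed
    show "(\<lambda>t. ((butlast t, tl t), last t, hd t)) ` cores c (h + 1) \<subseteq> overlaps c h"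
    proof (rule image_subsetI)
      fix t assume "t \<in> cores c (h + 1)"
      then have t: "length t = Suc h" "core c t" "t \<noteq> []" by (auto simp: cores_def)
      then show "((butlast t, tl t), last t, hd t) \<in> overlaps c h"
        using butlast_tl_in_halves_iff assms by (simp add: overlaps_def)
    qed
    show "\<forall>p\<in>overlaps c h. (\<lambda>t. ((butlast t, tl t), last t, hd t)) ((\<lambda>((u, v), x, y). u @ [x]) p) = p"
    proof
      fix p assume p: "p \<in> overlaps c h"
      obtain u v x y where uvxy: "p = ((u, v), x, y)" by (metis surj_pair)
      then have uv: "u @ [x] = y # v" using p by (auto simp: overlaps_def)
      have "tl (u @ [x]) = v" "hd (u @ [x]) = y" unfolding uv by simp_all
      then show "(\<lambda>t. ((butlast t, tl t), last t, hd t)) ((\<lambda>((u, v), x, y). u @ [x]) p) = p"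
        by (simp add: uvxy)
    qed
    show "\<forall>t\<in>cores c (h + 1). (\<lambda>((u, v), x, y). u @ [x]) ((butlast t, tl t), last t, hd t) = t"
      by (auto simp: cores_def intro!: append_butlast_last_id)
  qed
  then show ?thesis by (rule bij_betw_same_card)
qed

text \<open>Each pair has two possible middle letters, and an insertion fails exactly when it
  creates a border of length \<open>h + 1\<close>.\<close>

lemma card_cores_odd:
  assumes "h \<ge> 2"
  shows "card (cores c (2 * h + 1)) + card (cores c (h + 1)) = 2 * card (halves c h)"
proof -
  let ?T = "halves c h \<times> (UNIV :: coin set)"
  let ?O = "{((u, v), x). (u, v) \<in> halves c h \<and> u @ [x] = x # v}"
  have "bij_betw (\<lambda>((u, v), x). u @ x # v) (?T - ?O) (cores c (2 * h + 1))"
  proof (rule bij_betw_byWitness[where f' = "\<lambda>w. ((take h w, drop (Suc h) w), w ! h)"])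
    show "(\<lambda>w. ((take h w, drop (Suc h) w), w ! h)) ` cores c (2 * h + 1) \<subseteq> ?T - ?O"
    proof (rule image_subsetI)
      fix w assume "w \<in> cores c (2 * h + 1)"
      then have w: "length w = 2 * h + 1" "core c w" by (auto simp: cores_def)
      then have "w = take h w @ w ! h # drop (Suc h) w" by (simp add: id_take_nth_drop)
      then have "(take h w, drop (Suc h) w) \<in> halves c h \<and> take h w @ [w ! h] \<noteq> w ! h # drop (Suc h) w"
        using core_append_Cons_iff[OF _ _ assms, of "take h w" "drop (Suc h) w" c "w ! h"] w by simp
      then show "((take h w, drop (Suc h) w), w ! h) \<in> ?T - ?O" by simp
    qed
    show "(\<lambda>((u, v), x). u @ x # v) ` (?T - ?O) \<subseteq> cores c (2 * h + 1)"
    proof (rule image_subsetI)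
      fix p assume p: "p \<in> ?T - ?O"
      obtain u v x where uvx: "p = ((u, v), x)" by (metis surj_pair)
      then have "length u = h" "length v = h" using p by (auto simp: halves_def)
      then show "(\<lambda>((u, v), x). u @ x # v) p \<in> cores c (2 * h + 1)"
        using core_append_Cons_iff[OF _ _ assms, of u v c x] p uvx by (simp add: cores_def)
    qed
    show "\<forall>w\<in>cores c (2 * h + 1). (\<lambda>((u, v), x). u @ x # v) ((take h w, drop (Suc h) w), w ! h) = w"
      by (auto simp: cores_def id_take_nth_drop[symmetric])
  qed (auto simp: halves_def)
  then have "card (cores c (2 * h + 1)) = card (?T - ?O)" by (simp add: bij_betw_same_card)
  moreover have "bij_betw (\<lambda>(p, x). (p, x, x)) ?O (overlaps c h)"
  proof (rule bij_betw_byWitness[where f' = "\<lambda>(p, x, y). (p, x)"])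
    \<comment> \<open>Both letters are \<open>c\<close>: \<open>y\<close> is the first letter of
      \<open>u\<close> and \<open>x\<close> the last of \<open>v\<close>. So demanding equal letters
      removes none of \<open>overlaps\<close>.\<close>
    have eq: "x = y" if "(u, v) \<in> halves c h" "u @ [x] = y # v" for u v x y
    proof -
      have "(u @ [x]) ! 0 = (y # v) ! 0" "(u @ [x]) ! h = (y # v) ! h" using that(2) by auto
      then show ?thesis using that(1) assms by (auto simp: halves_def nth_append nth_Cons')
    qed
    show "\<forall>q\<in>overlaps c h. (\<lambda>(p, x). (p, x, x)) ((\<lambda>(p, x, y). (p, x)) q) = q"
      using eq by (auto simp: overlaps_def)
    show "(\<lambda>(p, x, y). (p, x)) ` overlaps c h \<subseteq> ?O"
      using eq by (fastforce simp: overlaps_def)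
  qed (auto simp: overlaps_def)
  then have "card (cores c (h + 1)) = card ?O"
    using card_overlaps[OF assms, of c] by (simp add: bij_betw_same_card)
  moreover have "card ?T = card (?T \<inter> ?O) + card (?T - ?O)"
    by (intro card_Int_Diff finite_cartesian_product finite_halves finite_coin)
  moreover have "?T \<inter> ?O = ?O" by auto
  ultimately show ?thesis by (simp add: card_cartesian_product UNIV_coin)
qed

lemma card_halves_Suc:
  assumes "h \<ge> 2"
  shows "card (halves c (Suc h)) + card (cores c (h + 1)) = 4 * card (halves c h)"
proof -
  let ?T = "halves c h \<times> (UNIV :: coin set) \<times> (UNIV :: coin set)"
  let ?O = "{((u, v), x, y). (u, v) \<in> halves c h \<and> u @ [x] = y # v}"
  have "bij_betw (\<lambda>((u, v), x, y). (u @ [x], y # v)) (?T - ?O) (halves c (Suc h))"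
  proof (rule bij_betw_byWitness[where f' = "\<lambda>(s, t). ((butlast s, tl t), last s, hd t)"])
    show "(\<lambda>(s, t). ((butlast s, tl t), last s, hd t)) ` halves c (Suc h) \<subseteq> ?T - ?O"
    proof (rule image_subsetI)
      fix p assume p: "p \<in> halves c (Suc h)"
      obtain s t where st: "p = (s, t)" by (cases p)
      have len: "length s = Suc h" "length t = Suc h" using p st by (auto simp: halves_def)
      then have "s = butlast s @ [last s]" "t = hd t # tl t" by (auto simp: length_Suc_conv)
      then have "(butlast s, tl t) \<in> halves c h \<and> butlast s @ [last s] \<noteq> hd t # tl t"
        using snoc_Cons_in_halves_iff[OF _ _ assms, of "butlast s" "tl t" "last s" "hd t" c] p st len
        by simp
      then show "(\<lambda>(s, t). ((butlast s, tl t), last s, hd t)) p \<in> ?T - ?O" by (simp add: st)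
    qed
    show "(\<lambda>((u, v), x, y). (u @ [x], y # v)) ` (?T - ?O) \<subseteq> halves c (Suc h)"
    proof (rule image_subsetI)
      fix p assume p: "p \<in> ?T - ?O"
      obtain u v x y where uvxy: "p = ((u, v), x, y)" by (metis surj_pair)
      then have "length u = h" "length v = h" using p by (auto simp: halves_def)
      then show "(\<lambda>((u, v), x, y). (u @ [x], y # v)) p \<in> halves c (Suc h)"
        using snoc_Cons_in_halves_iff[OF _ _ assms, of u v x y c] p uvxy by simp
    qed
    show "\<forall>p\<in>halves c (Suc h). (\<lambda>((u, v), x, y). (u @ [x], y # v)) ((\<lambda>(s, t). ((butlast s, tl t), last s, hd t)) p) = p"
    proof
      fix p assume p: "p \<in> halves c (Suc h)"
      obtain s t where st: "p = (s, t)" by (cases p)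
      have "s \<noteq> []" "t \<noteq> []" using p st by (auto simp: halves_def)
      then show "(\<lambda>((u, v), x, y). (u @ [x], y # v)) ((\<lambda>(s, t). ((butlast s, tl t), last s, hd t)) p) = p"
        by (simp add: st)
    qed
  qed auto
  then have "card (halves c (Suc h)) = card (?T - ?O)" by (simp add: bij_betw_same_card)
  moreover have "card (cores c (h + 1)) = card ?O"
    using card_overlaps[OF assms] by (simp add: overlaps_def)
  moreover have "card ?T = card (?T \<inter> ?O) + card (?T - ?O)"
    by (intro card_Int_Diff finite_cartesian_product finite_halves finite_coin)
  moreover have "?T \<inter> ?O = ?O" by auto
  ultimately show ?thesis by (simp add: card_cartesian_product UNIV_coin)
qed

section \<open>From cores back to optimal strings\<close>

lemma num_optimal_eq:
  assumes "L \<ge> 3"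
  shows "num_optimal (Suc L) = card (cores Heads L) + card (cores Tails L)"
proof -
  let ?f = "\<lambda>c. (\<lambda>w. w @ [c]) ` cores c L"
  have "optimal_strategies (Suc L) = (\<Union>c. ?f c)"
    unfolding optimal_strategies_eq[OF assms] cores_def by auto
  then have "optimal_strategies (Suc L) = ?f Heads \<union> ?f Tails"
    by (simp add: UNIV_coin)
  moreover have "?f Heads \<inter> ?f Tails = {}" by auto
  moreover have "card (?f c) = card (cores c L)" for c
    by (intro card_image inj_onI) simp
  ultimately show ?thesis
    unfolding num_optimal_def by (simp add: card_Un_disjoint)
qed

theorem theorem1p1:
  fixes n :: nat
  assumes "n \<ge> 6"
  shows "int (num_optimal n) =
    2 * int (num_optimal (n - 1)) - (- 1) ^ n * int (num_optimal (n div 2 + 1))"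
proof (cases "even n")
  case True
  then obtain k where "n = 2 * k" by blast
  \<comment> \<open>The prefixes have lengths \<open>2 * h + 1\<close> for \<open>n\<close> and
    \<open>2 * h\<close> for \<open>n - 1\<close>, so \<open>card_cores_odd\<close> is the
    recurrence.\<close>
  then obtain h where n: "n = Suc (2 * h + 1)" "h \<ge> 2"
    using assms by (cases k) auto
  have "n - 1 = Suc (2 * h)" "n div 2 + 1 = Suc (h + 1)" using n by auto
  then show ?thesis
    using num_optimal_eq[of "2 * h + 1"] num_optimal_eq[of "2 * h"] num_optimal_eq[of "h + 1"]
      card_cores_even[OF n(2), of Heads] card_cores_even[OF n(2), of Tails]
      card_cores_odd[OF n(2), of Heads] card_cores_odd[OF n(2), of Tails] n True
    by simp
next
  case False
  then obtain k where "n = 2 * k + 1" using oddE by blast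
  \<comment> \<open>With \<open>H\<close> pairs in \<open>halves c h\<close> and \<open>K\<close>
    cores of length \<open>h + 1\<close>, the counts are \<open>4H - K\<close> and
    \<open>2H - K\<close>; from \<open>4H - K = 2(2H - K) + K\<close> comes the opposite
    sign.\<close>
  then obtain h where n: "n = Suc (2 * Suc h)" "h \<ge> 2"
    using assms by (cases k) auto
  have "n - 1 = Suc (2 * h + 1)" "n div 2 + 1 = Suc (h + 1)" using n by auto
  moreover have "2 \<le> Suc h" using n by simp
  ultimately show ?thesis
    using num_optimal_eq[of "2 * Suc h"] num_optimal_eq[of "2 * h + 1"] num_optimal_eq[of "h + 1"]
      card_cores_even[of "Suc h" Heads] card_cores_even[of "Suc h" Tails]
      card_halves_Suc[OF n(2), of Heads] card_halves_Suc[OF n(2), of Tails]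
      card_cores_odd[OF n(2), of Heads] card_cores_odd[OF n(2), of Tails] n False
    by simp
qed

end
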